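(* Let $y(t)=a e^{-i\omega t}+\rho(t)$ on $[T_0,T_0+T]$ with $a\in\mathbb C$, $a\neq0$, $\omega\in\mathbb C$ and $\Im\omega\le0$. Fix $\Delta\in(0,T)$ and a nonnegative weight $w\in L^\infty([T_0,T_0+T-\Delta])$ with $0\le w\le1$ and $w\equiv1$ on $[T_0+\Delta,T_0+T-2\Delta]$. Put $z=e^{-i\omega\Delta}$, $y_0(t)=ae^{-i\omega t}$, $$\widehat z=\frac{\langle S_\Delta y,y\rangle_w}{\langle y,y\rangle_w},\qquad \varepsilon_0=\frac{\|\rho\|_w}{\|y_0\|_w},\quad \varepsilon_1=\frac{\|S_\Delta\rho\|_w}{\|y_0\|_w},\quad \varepsilon=\max\{\varepsilon_0,\varepsilon_1\}.$$ Assume $\varepsilon\le\min\{1/8,\,|z|/20\}$. Then $\widehat z\neq0$, $|\widehat z-z|\le\frac12|z|$, and for any holomorphic logarithm branch $\operatorname{Log}$ on a simply connected domain containing the segment between $z$ and $\widehat z$ and avoiding $0$, the estimator $\widehat\omega=\frac{i}{\Delta}\operatorname{Log}(\widehat z)$ satisfies $$|\widehat\omega-\omega|\le\frac{10}{\Delta|z|}\,\varepsilon=\frac{10}{\Delta}\,e^{-\Im\omega\,\Delta}\,\frac{\max\{\|\rho\|_w,\|S_\Delta\rho\|_w\}}{\|ae^{-i\omega t}\|_w}.$$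
   Context: $\langle f,g\rangle_w=\int_{T_0}^{T_0+T-\Delta}w(t)f(t)\overline{g(t)}\,dt$, $\|f\|_w=\langle f,f\rangle_w^{1/2}$, and $(S_\Delta f)(t)=f(t+\Delta)$ for a.e. $t\in[T_0,T_0+T-\Delta]$. The function $\rho$ is an unknown deterministic error; $\widehat z$ is defined whenever $\langle y,y\rangle_w>0$.
   Formalization: The bound on |ω̂−ω| is stated for branches with Log z = −iωΔ; for any other branch it holds up to a shift 2πk/Δ, k an integer (with ρ=0, Log+2πi violates the literal claim). ‖y₀‖_w>0 and finite w-norms of ρ, S_Δρ are assumed so that ε is defined. *)

theory Defs
  imports "HOL-Complex_Analysis.Complex_Analysis"
begin

definition window :: "real \<Rightarrow> real \<Rightarrow> real \<Rightarrow> real set" where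
  "window T0 T \<Delta> = {T0 .. T0 + T - \<Delta>}"

definition w_inner ::
  "real \<Rightarrow> real \<Rightarrow> real \<Rightarrow> (real \<Rightarrow> real) \<Rightarrow> (real \<Rightarrow> complex) \<Rightarrow> (real \<Rightarrow> complex) \<Rightarrow> complex" where
  "w_inner T0 T \<Delta> w f g =
     (LINT t|lebesgue_on (window T0 T \<Delta>). complex_of_real (w t) * f t * cnj (g t))"

(* For w \<ge> 0 the value w_inner f f is a nonnegative real, embedded in the complex numbers. *)
definition w_norm ::
  "real \<Rightarrow> real \<Rightarrow> real \<Rightarrow> (real \<Rightarrow> real) \<Rightarrow> (real \<Rightarrow> complex) \<Rightarrow> real" where
  "w_norm T0 T \<Delta> w f = sqrt (Re (w_inner T0 T \<Delta> w f f))"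

(* Bochner integrals of non-integrable functions are 0, so finiteness of w_norm f
   has to be demanded separately. *)
definition w_square_integrable ::
  "real \<Rightarrow> real \<Rightarrow> real \<Rightarrow> (real \<Rightarrow> real) \<Rightarrow> (real \<Rightarrow> complex) \<Rightarrow> bool" where
  "w_square_integrable T0 T \<Delta> w f \<longleftrightarrow>
     integrable (lebesgue_on (window T0 T \<Delta>)) (\<lambda>t. w t * (cmod (f t))\<^sup>2)"

definition shift :: "real \<Rightarrow> (real \<Rightarrow> complex) \<Rightarrow> real \<Rightarrow> complex" where
  "shift \<Delta> f = (\<lambda>t. f (t + \<Delta>))"

definition z_hat ::
  "real \<Rightarrow> real \<Rightarrow> real \<Rightarrow> (real \<Rightarrow> real) \<Rightarrow> (real \<Rightarrow> complex) \<Rightarrow> complex" where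
  "z_hat T0 T \<Delta> w y = w_inner T0 T \<Delta> w (shift \<Delta> y) y / w_inner T0 T \<Delta> w y y"

definition log_branch_on :: "(complex \<Rightarrow> complex) \<Rightarrow> complex set \<Rightarrow> bool" where
  "log_branch_on L D \<longleftrightarrow>
     open D \<and> simply_connected D \<and> 0 \<notin> D \<and> L holomorphic_on D \<and> (\<forall>u\<in>D. exp (L u) = u)"

definition omega_hat :: "real \<Rightarrow> (complex \<Rightarrow> complex) \<Rightarrow> complex \<Rightarrow> complex" where
  "omega_hat \<Delta> L zh = \<i> / complex_of_real \<Delta> * L zh"

end

theory Submission
  imports Defs
begin

text \<open>Shifting the exponential \<open>y0\<close> by \<open>\<Delta>\<close> multiplies it by
  \<open>z\<close>, so on the window \<open>shift \<Delta> y\<close> equals \<open>z\<close> times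
  \<open>y\<close> plus the error \<open>shift \<Delta> \<rho>\<close> minus \<open>z\<close> times
  \<open>\<rho>\<close>. Hence \<open>zh - z\<close> is the weighted inner product of this error
  with \<open>y\<close>, divided by the squared norm of \<open>y\<close>. Cauchy-Schwarz bounds it
  by the norm of the error over the norm of \<open>y\<close>. Because \<open>cmod z \<le> 1\<close>,
  the error has norm at most \<open>2 * \<epsilon>\<close> times that of \<open>y0\<close>, and
  \<open>\<epsilon> \<le> 1 / 8\<close> keeps the norm of \<open>y\<close> above
  \<open>7 / 8\<close> of it; this is \<open>rayleigh_quotient_error\<close>.

  Because also \<open>\<epsilon> \<le> cmod z / 20\<close>, the segment from \<open>z\<close> to
  \<open>zh\<close> stays within \<open>cmod z / 2\<close> of \<open>z\<close>. There every
  logarithm branch has derivative \<open>1 / u\<close> of modulus at most \<open>2 / cmod z\<close>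
  (\<open>log_branch_Lipschitz\<close>), and dividing by \<open>\<Delta>\<close> gives the frequency
  bound. The value of a branch at \<open>z\<close> is fixed only up to multiples of
  \<open>2 * pi * \<i>\<close>, so a general branch recovers \<open>\<omega>\<close> modulo
  \<open>2 * pi / \<Delta>\<close>, and the branch normalised at \<open>z\<close> recovers
  \<open>\<omega>\<close> itself.\<close>

section \<open>Cauchy-Schwarz and Minkowski for complex functions on an arbitrary measure
  space\<close>

definition l2_norm :: "'a measure \<Rightarrow> ('a \<Rightarrow> complex) \<Rightarrow> real" where
  "l2_norm M f = sqrt (\<integral>t. (cmod (f t))\<^sup>2 \<partial>M)"

text \<open>Measurability of \<open>f\<close> is a separate conjunct because integrability of the
  squared modulus does not imply it.\<close>

definition square_integrable :: "'a measure \<Rightarrow> ('a \<Rightarrow> complex) \<Rightarrow> bool" where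
  "square_integrable M f \<longleftrightarrow> f \<in> borel_measurable M \<and> integrable M (\<lambda>t. (cmod (f t))\<^sup>2)"

lemma square_integrable_cong:
  "(\<And>t. t \<in> space M \<Longrightarrow> f t = g t) \<Longrightarrow> square_integrable M f \<longleftrightarrow> square_integrable M g"
  unfolding square_integrable_def
  by (intro conj_cong measurable_cong Bochner_Integration.integrable_cong) auto

lemma l2_norm_nonneg [simp]: "0 \<le> l2_norm M f"
  by (simp add: l2_norm_def)

lemma l2_norm_squared: "(l2_norm M f)\<^sup>2 = (\<integral>t. (cmod (f t))\<^sup>2 \<partial>M)"
  by (simp add: l2_norm_def)

lemma integrable_cmod_mult:
  assumes f: "square_integrable M f" and g: "square_integrable M g"
  shows "integrable M (\<lambda>t. cmod (f t) * cmod (g t))"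
proof (rule Bochner_Integration.integrable_bound)
  show "integrable M (\<lambda>t. (cmod (f t))\<^sup>2 + (cmod (g t))\<^sup>2)"
    using f g by (auto simp: square_integrable_def)
  show "(\<lambda>t. cmod (f t) * cmod (g t)) \<in> borel_measurable M"
    using f g by (auto simp: square_integrable_def)
  have "p * q \<le> p\<^sup>2 + q\<^sup>2" if "0 \<le> p" "0 \<le> q" for p q :: real
    using sum_squares_bound[of p q] mult_nonneg_nonneg[OF that] by linarith
  then show "AE t in M. norm (cmod (f t) * cmod (g t)) \<le> norm ((cmod (f t))\<^sup>2 + (cmod (g t))\<^sup>2)"
    by auto
qed

lemma borel_measurable_mult_cnj:
  fixes f g :: "'a \<Rightarrow> complex"
  assumes [measurable]: "f \<in> borel_measurable M" "g \<in> borel_measurable M"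
  shows "(\<lambda>t. f t * cnj (g t)) \<in> borel_measurable M"
proof -
  have [measurable]: "cnj \<in> borel_measurable borel"
    by (intro borel_measurable_continuous_onI continuous_on_cnj continuous_on_id)
  show ?thesis by measurable
qed

lemma integrable_mult_cnj:
  assumes f: "square_integrable M f" and g: "square_integrable M g"
  shows "integrable M (\<lambda>t. f t * cnj (g t))"
proof (rule Bochner_Integration.integrable_bound[OF integrable_cmod_mult[OF f g]])
  show "(\<lambda>t. f t * cnj (g t)) \<in> borel_measurable M"
    using f g by (intro borel_measurable_mult_cnj) (auto simp: square_integrable_def)
qed (simp add: norm_mult)

text \<open>Cauchy-Schwarz for the moduli: the integral of
  \<open>(cmod (f t) + s * cmod (g t))\<^sup>2\<close> is a real quadratic in \<open>s\<close> that
  never becomes negative.\<close>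

lemma integral_cmod_mult_le:
  assumes f: "square_integrable M f" and g: "square_integrable M g"
  shows "(\<integral>t. cmod (f t) * cmod (g t) \<partial>M) \<le> l2_norm M f * l2_norm M g"
proof -
  define A B C where "A = (\<integral>t. (cmod (f t))\<^sup>2 \<partial>M)"
    and "B = (\<integral>t. cmod (f t) * cmod (g t) \<partial>M)"
    and "C = (\<integral>t. (cmod (g t))\<^sup>2 \<partial>M)"
  have fi: "integrable M (\<lambda>t. (cmod (f t))\<^sup>2)" and gi: "integrable M (\<lambda>t. (cmod (g t))\<^sup>2)"
    using f g by (auto simp: square_integrable_def)
  note fgi = integrable_cmod_mult[OF f g]
  have C0: "0 \<le> C" by (simp add: C_def)
  have quad: "0 \<le> A + 2 * s * B + s\<^sup>2 * C" for s
  proof -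
    have "0 \<le> (\<integral>t. (cmod (f t) + s * cmod (g t))\<^sup>2 \<partial>M)" by simp
    also have "\<dots> = (\<integral>t. (cmod (f t))\<^sup>2 + 2 * s * (cmod (f t) * cmod (g t)) + s\<^sup>2 * (cmod (g t))\<^sup>2 \<partial>M)"
      by (simp add: power2_eq_square algebra_simps)
    also have "\<dots> = A + 2 * s * B + s\<^sup>2 * C"
      using fi gi fgi by (simp add: A_def B_def C_def)
    finally show ?thesis .
  qed
  have "B\<^sup>2 \<le> A * C"
  proof (cases "C = 0")
    case True
    \<comment> \<open>With \<open>C = 0\<close> the quadratic is affine in \<open>s\<close>; if
      \<open>B\<close> were nonzero, the chosen \<open>s\<close> would give it the value -1.\<close>
    have "B = 0"
    proof (rule ccontr)
      assume "B \<noteq> 0"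
      then show False
        using quad[of "- (A + 1) / (2 * B)"] by (simp add: True field_simps)
    qed
    then show ?thesis by (simp add: True)
  next
    case False
    \<comment> \<open>The point \<open>- B / C\<close> is the minimiser of the quadratic.\<close>
    then have "A + 2 * (- B / C) * B + (- B / C)\<^sup>2 * C = (A * C - B\<^sup>2) / C"
      by (simp add: field_simps power2_eq_square)
    then show ?thesis
      using quad[of "- B / C"] C0 False by (simp add: zero_le_divide_iff)
  qed
  then have "B \<le> sqrt (A * C)" by (rule real_le_rsqrt)
  then show ?thesis by (simp add: A_def B_def C_def l2_norm_def real_sqrt_mult)
qed

lemma cmod_integral_mult_cnj_le:
  assumes "square_integrable M f" "square_integrable M g"
  shows "cmod (\<integral>t. f t * cnj (g t) \<partial>M) \<le> l2_norm M f * l2_norm M g"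
  using integral_norm_bound[of M "\<lambda>t. f t * cnj (g t)"] integral_cmod_mult_le[OF assms]
  by (simp add: norm_mult)

lemma integral_mult_cnj_self:
  "(\<integral>t. f t * cnj (f t) \<partial>M) = complex_of_real ((l2_norm M f)\<^sup>2)"
  by (simp add: l2_norm_squared flip: complex_norm_square of_real_power)

lemma square_integrable_cmult:
  "square_integrable M f \<Longrightarrow> square_integrable M (\<lambda>t. c * f t)"
  by (auto simp: square_integrable_def norm_mult power_mult_distrib)

lemma l2_norm_cmult: "l2_norm M (\<lambda>t. c * f t) = cmod c * l2_norm M f"
  by (simp add: l2_norm_def norm_mult power_mult_distrib real_sqrt_mult)

text \<open>Both claims come from one pointwise majorant, the expanded square of
  \<open>cmod (f t) + cmod (g t)\<close>; Cauchy-Schwarz then controls its cross term.\<close>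

lemma
  assumes f: "square_integrable M f" and g: "square_integrable M g"
  shows square_integrable_add: "square_integrable M (\<lambda>t. f t + g t)"
    and l2_norm_triangle: "l2_norm M (\<lambda>t. f t + g t) \<le> l2_norm M f + l2_norm M g"
proof -
  let ?h = "\<lambda>t. (cmod (f t))\<^sup>2 + 2 * (cmod (f t) * cmod (g t)) + (cmod (g t))\<^sup>2"
  have fi: "integrable M (\<lambda>t. (cmod (f t))\<^sup>2)" and gi: "integrable M (\<lambda>t. (cmod (g t))\<^sup>2)"
    using f g by (auto simp: square_integrable_def)
  have hi: "integrable M ?h"
    using fi gi integrable_cmod_mult[OF f g] by simp
  have le: "(cmod (f t + g t))\<^sup>2 \<le> ?h t" for t
    using power_mono[OF norm_triangle_ineq[of "f t" "g t"], of 2]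
    by (simp add: power2_eq_square algebra_simps)
  have meas: "(\<lambda>t. f t + g t) \<in> borel_measurable M"
    using f g by (auto simp: square_integrable_def)
  have int: "integrable M (\<lambda>t. (cmod (f t + g t))\<^sup>2)"
  proof (rule Bochner_Integration.integrable_bound[OF hi])
    show "AE t in M. norm ((cmod (f t + g t))\<^sup>2) \<le> norm (?h t)"
      using le by (intro always_eventually allI) (auto intro: order_trans)
  qed (use meas in auto)
  then show "square_integrable M (\<lambda>t. f t + g t)"
    using meas by (simp add: square_integrable_def)
  have "(l2_norm M (\<lambda>t. f t + g t))\<^sup>2 \<le> (\<integral>t. ?h t \<partial>M)"
    unfolding l2_norm_squared by (intro integral_mono int hi le)
  also have "\<dots> = (l2_norm M f)\<^sup>2 + 2 * (\<integral>t. cmod (f t) * cmod (g t) \<partial>M) + (l2_norm M g)\<^sup>2"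
    using fi gi integrable_cmod_mult[OF f g] by (simp add: l2_norm_squared)
  also have "\<dots> \<le> (l2_norm M f + l2_norm M g)\<^sup>2"
    using integral_cmod_mult_le[OF f g] by (simp add: power2_sum)
  finally show "l2_norm M (\<lambda>t. f t + g t) \<le> l2_norm M f + l2_norm M g"
    by (rule power2_le_imp_le) simp
qed

section \<open>Perturbation of the quotient\<close>

text \<open>Since \<open>g - z f = \<sigma> - z \<rho>\<close>, the error of the quotient is
  \<open>\<langle>\<sigma> - z \<rho>, f\<rangle> / \<parallel>f\<parallel>\<^sup>2\<close>, with numerator at most \<open>2 \<epsilon> N \<parallel>f\<parallel>\<close> and \<open>\<parallel>f\<parallel> \<ge> (1 - \<epsilon>) N\<close>.\<close>
lemma rayleigh_quotient_error:
  fixes z :: complex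
  assumes f0: "square_integrable M f0" and \<rho>: "square_integrable M \<rho>" and \<sigma>: "square_integrable M \<sigma>"
    and f: "\<And>t. t \<in> space M \<Longrightarrow> f t = f0 t + \<rho> t"
    and g: "\<And>t. t \<in> space M \<Longrightarrow> g t = z * f0 t + \<sigma> t"
    and N: "0 < l2_norm M f0"
    and \<rho>_le: "l2_norm M \<rho> \<le> \<epsilon> * l2_norm M f0" and \<sigma>_le: "l2_norm M \<sigma> \<le> \<epsilon> * l2_norm M f0"
    and \<epsilon>: "\<epsilon> \<le> 1 / 8" and z: "cmod z \<le> 1"
  shows "cmod ((\<integral>t. g t * cnj (f t) \<partial>M) / (\<integral>t. f t * cnj (f t) \<partial>M) - z) \<le> 16 / 7 * \<epsilon>"
proof -
  let ?N = "l2_norm M f0" and ?F = "l2_norm M f"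
  define e where "e t = \<sigma> t + (- z) * \<rho> t" for t
  have l2_norm_f: "l2_norm M f = l2_norm M (\<lambda>t. f0 t + \<rho> t)"
    unfolding l2_norm_def by (intro arg_cong[where f = sqrt] Bochner_Integration.integral_cong) (auto simp: f)
  have f_sq: "square_integrable M f"
    using square_integrable_add[OF f0 \<rho>] f by (simp cong: square_integrable_cong)
  have e_sq: "square_integrable M e"
    unfolding e_def by (intro square_integrable_add square_integrable_cmult \<rho> \<sigma>)
  have \<epsilon>0: "0 \<le> \<epsilon>"
    using order_trans[OF l2_norm_nonneg \<rho>_le] N by (simp add: zero_le_mult_iff)
  have "l2_norm M e \<le> l2_norm M \<sigma> + cmod z * l2_norm M \<rho>"
    using l2_norm_triangle[OF \<sigma> square_integrable_cmult[OF \<rho>], of "- z"]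
    unfolding l2_norm_cmult e_def norm_minus_cancel .
  \<comment> \<open>The bound \<open>cmod z \<le> 1\<close> enters here: the two noise terms then
    contribute equally.\<close>
  also have "\<dots> \<le> \<epsilon> * ?N + 1 * (\<epsilon> * ?N)"
    using z by (intro add_mono mult_mono \<sigma>_le \<rho>_le) auto
  finally have e_le: "l2_norm M e \<le> 2 * \<epsilon> * ?N" by simp
  \<comment> \<open>Reverse triangle inequality: \<open>f0\<close> is written as \<open>f\<close>
    minus \<open>\<rho>\<close> to bound the norm of \<open>f\<close> from below.\<close>
  have "?N = l2_norm M (\<lambda>t. f t + (- 1) * \<rho> t)"
    unfolding l2_norm_def by (intro arg_cong[where f = sqrt] Bochner_Integration.integral_cong) (auto simp: f)
  also have "\<dots> \<le> ?F + l2_norm M \<rho>"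
    using l2_norm_triangle[OF f_sq square_integrable_cmult[OF \<rho>], of "- 1"]
    by (simp only: l2_norm_cmult) simp
  finally have "?N \<le> ?F + \<epsilon> * ?N" using \<rho>_le by simp
  moreover have "\<epsilon> * ?N \<le> 1 / 8 * ?N"
    using \<epsilon> N by (intro mult_right_mono) auto
  ultimately have F_ge: "7 / 8 * ?N \<le> ?F" by linarith
  with N have F: "0 < ?F" by linarith
  have "(\<integral>t. g t * cnj (f t) \<partial>M) = (\<integral>t. z * (f t * cnj (f t)) + e t * cnj (f t) \<partial>M)"
    by (intro Bochner_Integration.integral_cong refl) (simp add: f g e_def algebra_simps)
  also have "\<dots> = z * (\<integral>t. f t * cnj (f t) \<partial>M) + (\<integral>t. e t * cnj (f t) \<partial>M)"
    using integrable_mult_cnj[OF f_sq f_sq] integrable_mult_cnj[OF e_sq f_sq] by simp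
  finally have "(\<integral>t. g t * cnj (f t) \<partial>M) / (\<integral>t. f t * cnj (f t) \<partial>M) - z
      = (\<integral>t. e t * cnj (f t) \<partial>M) / complex_of_real (?F\<^sup>2)"
    using F by (simp add: integral_mult_cnj_self field_simps)
  then have "cmod ((\<integral>t. g t * cnj (f t) \<partial>M) / (\<integral>t. f t * cnj (f t) \<partial>M) - z)
      = cmod (\<integral>t. e t * cnj (f t) \<partial>M) / ?F\<^sup>2"
    by (simp add: norm_divide norm_power)
  also have "\<dots> \<le> (l2_norm M e * ?F) / ?F\<^sup>2"
    by (intro divide_right_mono cmod_integral_mult_cnj_le e_sq f_sq) simp
  also have "\<dots> = l2_norm M e / ?F"
    using F by (simp add: power2_eq_square)
  also have "\<dots> \<le> (2 * \<epsilon> * ?N) / (7 / 8 * ?N)"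
    using e_le F_ge N \<epsilon>0 by (intro frac_le) auto
  also have "\<dots> = 16 / 7 * \<epsilon>" using N by simp
  finally show ?thesis .
qed

section \<open>Translation and the weighted measure on the window\<close>

text \<open>Translation is measurable from Lebesgue sets to Lebesgue sets, which mere Borel
  measurability of the map would not give, and it sends the window into the full interval.\<close>

lemma borel_measurable_shift:
  assumes f: "f \<in> borel_measurable (lebesgue_on {T0 .. T0 + T})" and \<Delta>: "0 \<le> \<Delta>"
  shows "shift \<Delta> f \<in> borel_measurable (lebesgue_on (window T0 T \<Delta>))"
proof -
  have "(\<lambda>t::real. t + \<Delta>) \<in> lebesgue \<rightarrow>\<^sub>M lebesgue"
    using lebesgue_affine_measurable[of "\<lambda>_. 1" \<Delta>] by (simp add: add.commute)
  then have "(\<lambda>t. t + \<Delta>) \<in> lebesgue_on (window T0 T \<Delta>) \<rightarrow>\<^sub>M lebesgue_on {T0 .. T0 + T}"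
    using \<Delta> by (intro measurable_restrict_space2 measurable_restrict_space1) (auto simp: window_def)
  from measurable_compose[OF this f] show ?thesis
    by (simp add: shift_def)
qed

text \<open>Absorbing \<open>w\<close> into the measure turns the weighted inner product into an
  ordinary one. Since \<open>ennreal\<close> truncates negative values to 0, the transfer lemmas
  assume \<open>w\<close> nonnegative almost everywhere.\<close>

abbreviation weighted :: "real \<Rightarrow> real \<Rightarrow> real \<Rightarrow> (real \<Rightarrow> real) \<Rightarrow> real measure" where
  "weighted T0 T \<Delta> w \<equiv> density (lebesgue_on (window T0 T \<Delta>)) (\<lambda>t. ennreal (w t))"

lemma w_inner_eq_integral_weighted:
  assumes "w \<in> borel_measurable (lebesgue_on (window T0 T \<Delta>))"
    and "AE t in lebesgue_on (window T0 T \<Delta>). 0 \<le> w t"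
    and "f \<in> borel_measurable (lebesgue_on (window T0 T \<Delta>))"
    and "g \<in> borel_measurable (lebesgue_on (window T0 T \<Delta>))"
  shows "w_inner T0 T \<Delta> w f g = (\<integral>t. f t * cnj (g t) \<partial>weighted T0 T \<Delta> w)"
proof -
  from integral_density[OF borel_measurable_mult_cnj[OF assms(3,4)] assms(1,2)] show ?thesis
    by (simp add: w_inner_def scaleR_conv_of_real mult.assoc)
qed

lemma w_norm_eq_l2_norm:
  assumes "w \<in> borel_measurable (lebesgue_on (window T0 T \<Delta>))"
    and "AE t in lebesgue_on (window T0 T \<Delta>). 0 \<le> w t"
    and "f \<in> borel_measurable (lebesgue_on (window T0 T \<Delta>))"
  shows "w_norm T0 T \<Delta> w f = l2_norm (weighted T0 T \<Delta> w) f"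
  by (simp add: w_norm_def w_inner_eq_integral_weighted[OF assms assms(3)] integral_mult_cnj_self
      del: of_real_power)

lemma w_square_integrable_eq:
  assumes "w \<in> borel_measurable (lebesgue_on (window T0 T \<Delta>))"
    and "AE t in lebesgue_on (window T0 T \<Delta>). 0 \<le> w t"
    and "f \<in> borel_measurable (lebesgue_on (window T0 T \<Delta>))"
  shows "w_square_integrable T0 T \<Delta> w f \<longleftrightarrow> square_integrable (weighted T0 T \<Delta> w) f"
proof -
  have "(\<lambda>t. (cmod (f t))\<^sup>2) \<in> borel_measurable (lebesgue_on (window T0 T \<Delta>))"
    using assms(3) by simp
  from integrable_density[OF this assms(1,2)] show ?thesis
    using assms(3) by (simp add: w_square_integrable_def square_integrable_def)
qed

section \<open>Holomorphic logarithm branches\<close>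

text \<open>Differentiating \<open>exp (L v) = v\<close> at \<open>u\<close> gives
  \<open>u * deriv L u = 1\<close>; openness of \<open>D\<close> makes the identity hold near
  \<open>u\<close>.\<close>

lemma log_branch_has_field_derivative:
  assumes L: "log_branch_on L D" and u: "u \<in> D"
  shows "(L has_field_derivative 1 / u) (at u)"
proof -
  have D: "open D" "L holomorphic_on D" "0 \<notin> D" "\<And>v. v \<in> D \<Longrightarrow> exp (L v) = v"
    using L by (auto simp: log_branch_on_def)
  have L': "(L has_field_derivative deriv L u) (at u)"
    by (rule holomorphic_derivI[OF D(2,1) u])
  have "((\<lambda>v. exp (L v)) has_field_derivative exp (L u) * deriv L u) (at u)"
    by (intro derivative_intros L')
  moreover have "((\<lambda>v. exp (L v)) has_field_derivative 1) (at u)"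
    by (rule has_field_derivative_transform_within_open[of "\<lambda>v. v" _ _ D]) (use D u in auto)
  ultimately have "u * deriv L u = 1"
    using DERIV_unique D(4)[OF u] by fastforce
  moreover have "u \<noteq> 0" using D(3) u by blast
  ultimately have "deriv L u = 1 / u" by (simp add: eq_divide_eq mult.commute)
  with L' show ?thesis by simp
qed

text \<open>Mean value inequality along the segment: its points have modulus at least
  \<open>cmod z / 2\<close>, so the derivative \<open>1 / u\<close> is at most
  \<open>2 / cmod z\<close> there.\<close>

lemma log_branch_Lipschitz:
  assumes L: "log_branch_on L D" and sub: "closed_segment z z' \<subseteq> D"
    and close: "cmod (z' - z) \<le> cmod z / 2" and z: "z \<noteq> 0"
  shows "cmod (L z' - L z) \<le> 2 / cmod z * cmod (z' - z)"
proof (rule field_differentiable_bound[of "closed_segment z z'" L "\<lambda>u. 1 / u"])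
  fix u assume u: "u \<in> closed_segment z z'"
  then show "(L has_field_derivative 1 / u) (at u within closed_segment z z')"
    using log_branch_has_field_derivative[OF L] sub has_field_derivative_at_within by blast
  have "cmod (u - z) \<le> cmod z / 2"
    using segment_bound(1)[OF u] close by simp
  then have "cmod z / 2 \<le> cmod u"
    using norm_triangle_ineq2[of z "z - u"] norm_minus_commute[of u z] by simp
  then show "cmod (1 / u) \<le> 2 / cmod z"
    using z frac_le[of 1 1 "cmod z / 2" "cmod u"] by (simp add: norm_divide)
qed auto

section \<open>From the quotient error to the frequency error\<close>

theorem theorem6p6:
  fixes T0 T \<Delta> \<epsilon>0 \<epsilon>1 \<epsilon> :: real
    and a \<omega> z zh :: complex
    and w :: "real \<Rightarrow> real"
    and \<rho> y y0 :: "real \<Rightarrow> complex"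
  assumes a_nz: "a \<noteq> 0"
    and Im_omega: "Im \<omega> \<le> 0"
    and Delta: "0 < \<Delta>" "\<Delta> < T"
    and w_meas: "w \<in> borel_measurable (lebesgue_on (window T0 T \<Delta>))"
    and w_range: "AE t in lebesgue_on (window T0 T \<Delta>). 0 \<le> w t \<and> w t \<le> 1"
    and w_one: "AE t in lebesgue_on (window T0 T \<Delta>). t \<in> {T0 + \<Delta> .. T0 + T - 2 * \<Delta>} \<longrightarrow> w t = 1"
    and rho_meas: "\<rho> \<in> borel_measurable (lebesgue_on {T0 .. T0 + T})"
    and rho_L2: "w_square_integrable T0 T \<Delta> w \<rho>"
    and shift_rho_L2: "w_square_integrable T0 T \<Delta> w (shift \<Delta> \<rho>)"
    and y0: "y0 = (\<lambda>t. a * exp (- \<i> * \<omega> * complex_of_real t))"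
    and y: "\<And>t. t \<in> {T0 .. T0 + T} \<Longrightarrow> y t = a * exp (- \<i> * \<omega> * complex_of_real t) + \<rho> t"
    and y0_pos: "0 < w_norm T0 T \<Delta> w y0"
    and z: "z = exp (- \<i> * \<omega> * complex_of_real \<Delta>)"
    and zh: "zh = z_hat T0 T \<Delta> w y"
    and eps0: "\<epsilon>0 = w_norm T0 T \<Delta> w \<rho> / w_norm T0 T \<Delta> w y0"
    and eps1: "\<epsilon>1 = w_norm T0 T \<Delta> w (shift \<Delta> \<rho>) / w_norm T0 T \<Delta> w y0"
    and eps: "\<epsilon> = max \<epsilon>0 \<epsilon>1"
    and eps_small: "\<epsilon> \<le> min (1 / 8) (cmod z / 20)"
  shows "zh \<noteq> 0
    \<and> cmod (zh - z) \<le> 1 / 2 * cmod z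
    \<and> (\<forall>L D. log_branch_on L D \<and> closed_segment z zh \<subseteq> D \<longrightarrow>
          (L z = - \<i> * \<omega> * complex_of_real \<Delta> \<longrightarrow>
             cmod (omega_hat \<Delta> L zh - \<omega>) \<le> 10 / (\<Delta> * cmod z) * \<epsilon>)
        \<and> (\<exists>k::int. cmod (omega_hat \<Delta> L zh - (\<omega> + complex_of_real (2 * pi * of_int k / \<Delta>)))
             \<le> 10 / (\<Delta> * cmod z) * \<epsilon>))
    \<and> 10 / (\<Delta> * cmod z) * \<epsilon> =
        10 / \<Delta> * exp (- Im \<omega> * \<Delta>) *
          (max (w_norm T0 T \<Delta> w \<rho>) (w_norm T0 T \<Delta> w (shift \<Delta> \<rho>)) / w_norm T0 T \<Delta> w y0)"
proof -
  let ?M = "weighted T0 T \<Delta> w" and ?W = "lebesgue_on (window T0 T \<Delta>)"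
  have w0: "AE t in ?W. 0 \<le> w t" using w_range by eventually_elim simp
  have W_sub: "window T0 T \<Delta> \<subseteq> {T0 .. T0 + T}" using Delta by (auto simp: window_def)
  have \<rho>_W: "\<rho> \<in> borel_measurable ?W"
    using rho_meas W_sub by (rule measurable_restrict_mono)
  have S\<rho>_W: "shift \<Delta> \<rho> \<in> borel_measurable ?W"
    using borel_measurable_shift[OF rho_meas] Delta by simp
  have y0_W: "y0 \<in> borel_measurable ?W"
    unfolding y0 by (intro continuous_imp_measurable_on_sets_lebesgue continuous_intros)
      (simp add: window_def)
  have y_W_eq: "y t = y0 t + \<rho> t" if "t \<in> window T0 T \<Delta>" for t
    using y[of t] W_sub that by (auto simp: y0)
  \<comment> \<open>The exponential is an eigenfunction of the shift with eigenvalue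
    \<open>z\<close>; for \<open>t\<close> in the window, \<open>t + \<Delta>\<close> still lies
    where \<open>y\<close> is prescribed.\<close>
  have Sy_W_eq: "shift \<Delta> y t = z * y0 t + shift \<Delta> \<rho> t" if "t \<in> window T0 T \<Delta>" for t
    using y[of "t + \<Delta>"] that Delta
    by (simp add: window_def shift_def y0 z distrib_left mult_exp_exp[symmetric] exp_diff exp_minus
        field_simps)
  have y_W: "y \<in> borel_measurable ?W"
    by (subst measurable_cong[where g = "\<lambda>t. y0 t + \<rho> t"]) (use y0_W \<rho>_W y_W_eq in auto)
  have Sy_W: "shift \<Delta> y \<in> borel_measurable ?W"
    by (subst measurable_cong[where g = "\<lambda>t. z * y0 t + shift \<Delta> \<rho> t"])
      (use y0_W S\<rho>_W Sy_W_eq in auto)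
  note norms = w_norm_eq_l2_norm[OF w_meas w0]
  have y0_sq: "square_integrable ?M y0"
  proof -
    \<comment> \<open>The integral of a non-integrable function is 0 by convention, so positivity of
      the norm forces integrability.\<close>
    have "(\<integral>t. (cmod (y0 t))\<^sup>2 \<partial>?M) \<noteq> 0"
      using y0_pos unfolding norms[OF y0_W] l2_norm_def by auto
    then have "integrable ?M (\<lambda>t. (cmod (y0 t))\<^sup>2)"
      using not_integrable_integral_eq by blast
    then show ?thesis using y0_W by (simp add: square_integrable_def)
  qed
  have \<rho>_sq: "square_integrable ?M \<rho>" and S\<rho>_sq: "square_integrable ?M (shift \<Delta> \<rho>)"
    using rho_L2 shift_rho_L2 w_square_integrable_eq[OF w_meas w0] \<rho>_W S\<rho>_W by auto
  have cmod_z: "cmod z = exp (Im \<omega> * \<Delta>)" by (simp add: z)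
  have z_nz: "z \<noteq> 0" by (simp add: z)
  have \<epsilon>0: "0 \<le> \<epsilon>"
    using y0_pos by (simp add: eps eps0 norms[OF \<rho>_W] le_max_iff_disj)
  have zh_z: "cmod (zh - z) \<le> 16 / 7 * \<epsilon>"
    unfolding zh z_hat_def w_inner_eq_integral_weighted[OF w_meas w0 Sy_W y_W]
      w_inner_eq_integral_weighted[OF w_meas w0 y_W y_W]
  proof (rule rayleigh_quotient_error[OF y0_sq \<rho>_sq S\<rho>_sq])
    show "0 < l2_norm ?M y0" using y0_pos by (simp add: norms[OF y0_W])
    show "l2_norm ?M \<rho> \<le> \<epsilon> * l2_norm ?M y0" "l2_norm ?M (shift \<Delta> \<rho>) \<le> \<epsilon> * l2_norm ?M y0"
      using y0_pos by (auto simp: norms[OF y0_W] norms[OF \<rho>_W] norms[OF S\<rho>_W] eps eps0 eps1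
          simp flip: pos_divide_le_eq)
    show "\<epsilon> \<le> 1 / 8" using eps_small by simp
    show "cmod z \<le> 1"
      using Im_omega Delta by (simp add: cmod_z mult_nonpos_nonneg)
  qed (auto simp: y_W_eq Sy_W_eq)
  \<comment> \<open>Indeed \<open>16 / 7\<close> times \<open>cmod z / 20\<close> is
    \<open>4 / 35 * cmod z\<close>.\<close>
  then have zh_close: "cmod (zh - z) \<le> 1 / 2 * cmod z"
    using eps_small \<epsilon>0 by simp
  then have zh_nz: "zh \<noteq> 0" using z_nz by auto
  \<comment> \<open>The comparison is with \<open>L z\<close> rather than \<open>\<omega>\<close>,
    so that it covers every branch before any normalisation.\<close>
  have branch: "cmod (omega_hat \<Delta> L zh - \<i> / complex_of_real \<Delta> * L z) \<le> 10 / (\<Delta> * cmod z) * \<epsilon>"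
    if "log_branch_on L D" "closed_segment z zh \<subseteq> D" for L D
  proof -
    have "cmod (L zh - L z) \<le> 2 / cmod z * cmod (zh - z)"
      using log_branch_Lipschitz[OF that] zh_close z_nz by simp
    \<comment> \<open>Rounding \<open>16 / 7\<close> up to 5 yields the constant 10 of the
      theorem.\<close>
    also have "\<dots> \<le> 2 / cmod z * (5 * \<epsilon>)"
      using zh_z \<epsilon>0 by (intro mult_left_mono) auto
    finally have "cmod (L zh - L z) \<le> 10 / cmod z * \<epsilon>" by simp
    then have "cmod (L zh - L z) / \<Delta> \<le> 10 / cmod z * \<epsilon> / \<Delta>"
      using Delta by (intro divide_right_mono) auto
    moreover have "cmod (omega_hat \<Delta> L zh - \<i> / complex_of_real \<Delta> * L z) = cmod (L zh - L z) / \<Delta>"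
      unfolding omega_hat_def right_diff_distrib[symmetric]
      using Delta by (simp add: norm_mult norm_divide)
    ultimately show ?thesis by (simp add: mult.commute)
  qed
  show ?thesis
  proof (intro conjI allI impI; (elim conjE)?)
    show "zh \<noteq> 0" "cmod (zh - z) \<le> 1 / 2 * cmod z" by fact+
  next
    fix L D
    assume "log_branch_on L D" "closed_segment z zh \<subseteq> D" "L z = - \<i> * \<omega> * complex_of_real \<Delta>"
    then show "cmod (omega_hat \<Delta> L zh - \<omega>) \<le> 10 / (\<Delta> * cmod z) * \<epsilon>"
      using branch[of L D] Delta by simp
  next
    fix L D
    assume L: "log_branch_on L D" and D: "closed_segment z zh \<subseteq> D"
    then have "exp (L z) = exp (- \<i> * \<omega> * complex_of_real \<Delta>)"
      by (auto simp: log_branch_on_def z)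
    then obtain n :: int where n: "L z = - \<i> * \<omega> * complex_of_real \<Delta> + 2 * of_int n * pi * \<i>"
      using exp_eq[of "L z"] by auto
    \<comment> \<open>Multiplying the period \<open>2 * pi * n * \<i>\<close> by
      \<open>\<i> / \<Delta>\<close> flips its sign, so the witness for \<open>k\<close> is
      \<open>- n\<close>.\<close>
    then have "\<i> / complex_of_real \<Delta> * L z = \<omega> + complex_of_real (2 * pi * of_int (- n) / \<Delta>)"
      using Delta unfolding n by (simp add: field_simps)
    with branch[OF L D] show "\<exists>k::int. cmod (omega_hat \<Delta> L zh
        - (\<omega> + complex_of_real (2 * pi * of_int k / \<Delta>))) \<le> 10 / (\<Delta> * cmod z) * \<epsilon>"
      by metis
  next
    have "\<epsilon> = max (w_norm T0 T \<Delta> w \<rho>) (w_norm T0 T \<Delta> w (shift \<Delta> \<rho>)) / w_norm T0 T \<Delta> w y0"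
      using y0_pos by (simp add: eps eps0 eps1 max_divide_distrib_right)
    then show "10 / (\<Delta> * cmod z) * \<epsilon> = 10 / \<Delta> * exp (- Im \<omega> * \<Delta>) *
        (max (w_norm T0 T \<Delta> w \<rho>) (w_norm T0 T \<Delta> w (shift \<Delta> \<rho>)) / w_norm T0 T \<Delta> w y0)"
      by (simp add: cmod_z exp_minus divide_simps)
  qed
qed

end
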